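(* For every integer $k \geq 0$ there exists a finite abelian group $G$ such that $|\mathrm{Aut}(G)|/|G| = 2^k$.
   Context: $\mathrm{Aut}(G)$ denotes the group of automorphisms of the group $G$. *)

theory Defs
  imports Complex_Main "HOL-Algebra.Algebra"
begin

end

theory Submission
  imports Defs "HOL-Number_Theory.Totient"
begin

text \<open>Groups of rank two suffice. Let G = \<int>/a \<times> \<int>/ar. An endomorphism of G is a matrix
(\<alpha>, \<beta>; \<gamma>r, \<delta>), where \<alpha>, \<beta>, \<gamma> are taken modulo a and \<delta> modulo ar; the factor r appears because
the image of the first generator is killed by a. With D = \<alpha>\<delta> - r\<beta>\<gamma>, such a matrix is injective exactly
when D is a unit modulo a and no prime divisor of ar divides both D and \<delta>
(lemmas endo_inj_iff and trivial_kernel_iff). Hence counting automorphisms is counting such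
matrices (card_auto), and two cases of this count are enough.

If every prime divisor of a divides r, then D may be replaced by \<alpha>\<delta>, so \<alpha> and \<delta> are units and
\<beta>, \<gamma> are arbitrary (card_auto_eq_totients). The ratio is then a \<phi>(a) \<phi>(ar) / (ar). It
equals 4^j for \<int>/2^(j+1) \<times> \<int>/2^(j+2), which gives all even exponents, and it equals 2 for
\<int>/3 \<times> \<int>/18.

If r = 1 and a = 6q with q = 2^j, then only D modulo 6 matters. There are
6 \<cdot> 48 = 288 invertible matrices modulo 6, each with q^4 lifts (card_auto_homogeneous), so the
ratio is 288 q^4 / (6q)^2 = 8 \<cdot> 4^j. This gives all odd exponents from 3 on.\<close>

section \<open>Automorphism counts under isomorphism\<close>

lemma auto_conjugate:
  assumes "group B" "p \<in> iso B A" "q \<in> iso A B" "f \<in> auto A"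
  shows "restrict (q \<circ> f \<circ> p) (carrier B) \<in> auto B"
proof -
  have "f \<in> iso A A" using assms by (auto simp: auto_def Bij_def iso_def)
  then have "q \<circ> f \<circ> p \<in> iso B B" using assms by (meson iso_set_trans)
  then have i: "q \<circ> f \<circ> p \<in> hom B B" "bij_betw (q \<circ> f \<circ> p) (carrier B) (carrier B)"
    by (auto simp: iso_def)
  have "restrict (q \<circ> f \<circ> p) (carrier B) \<in> hom B B"
    using i(1) group.is_monoid[OF assms(1)] by (auto simp: hom_def monoid.m_closed)
  then show ?thesis using i(2) by (auto simp: auto_def Bij_def cong: bij_betw_cong)
qed

text \<open>Conjugation by an isomorphism is a bijection between the automorphism sets. The restrictions keep
the conjugates extensional, which makes the two conjugations exact inverses of each other.\<close>

lemma card_auto_iso: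
  assumes "group G" "group H" and h: "h \<in> iso G H"
  shows "card (auto G) = card (auto H)"
proof (rule bij_betw_same_card)
  let ?k = "inv_into (carrier G) h"
  have k: "?k \<in> iso H G" using group.iso_set_sym[OF assms(1,3)] .
  have hom: "h \<in> hom G H" "?k \<in> hom H G" and bij: "bij_betw h (carrier G) (carrier H)"
    using h k by (auto simp: iso_def)
  have kh: "?k (h x) = x" if "x \<in> carrier G" for x
    using bij that by (simp add: bij_betw_def)
  have hk: "h (?k y) = y" if "y \<in> carrier H" for y
    using bij that by (simp add: bij_betw_def f_inv_into_f)
  have hc: "h x \<in> carrier H" if "x \<in> carrier G" for x using hom that by (auto simp: hom_def)
  have kc: "?k x \<in> carrier G" if "x \<in> carrier H" for x using hom that by (auto simp: hom_def)
  show "bij_betw (\<lambda>f. restrict (h \<circ> f \<circ> ?k) (carrier H)) (auto G) (auto H)"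
  proof (rule bij_betw_byWitness[where f' = "\<lambda>f. restrict (?k \<circ> f \<circ> h) (carrier G)"])
    show "(\<lambda>f. restrict (h \<circ> f \<circ> ?k) (carrier H)) ` auto G \<subseteq> auto H"
      using auto_conjugate[OF _ k h] \<open>group H\<close> by auto
    show "(\<lambda>f. restrict (?k \<circ> f \<circ> h) (carrier G)) ` auto H \<subseteq> auto G"
      using auto_conjugate[OF _ h k] \<open>group G\<close> by auto
    show "\<forall>f\<in>auto G. restrict (?k \<circ> restrict (h \<circ> f \<circ> ?k) (carrier H) \<circ> h) (carrier G) = f"
      by (auto simp: auto_def Bij_def fun_eq_iff kh hc kc hom_def extensional_def Pi_iff)
    show "\<forall>f\<in>auto H. restrict (h \<circ> restrict (?k \<circ> f \<circ> h) (carrier G) \<circ> ?k) (carrier H) = f"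
      by (auto simp: auto_def Bij_def fun_eq_iff hk hc kc hom_def extensional_def Pi_iff)
  qed
qed

text \<open>Every finite abelian group with a countable element type can be renamed into natural numbers. The
groups studied below consist of pairs of integers and are moved to the natural numbers in this way.\<close>

lemma comm_group_nat_copy:
  fixes H :: "'a::countable monoid"
  assumes "comm_group H" "finite (carrier H)"
  shows "\<exists>G :: nat monoid. comm_group G \<and> finite (carrier G) \<and> to_nat \<in> iso H G"
proof (intro exI conjI)
  let ?G = "image_group to_nat H :: nat monoid"
  have inj: "inj_on to_nat (carrier H)" by (simp add: inj_on_def)
  show iso: "to_nat \<in> iso H ?G"
    using inj by (rule inj_imp_image_group_iso)
  have "comm_group (?G\<lparr>one := to_nat \<one>\<^bsub>H\<^esub>\<rparr>)"
    using comm_group.iso_imp_img_comm_group[OF assms(1) iso] .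
  then show "comm_group ?G" by (simp add: image_group_def)
  show "finite (carrier ?G)" using assms(2) by (simp add: image_group_carrier)
qed
section \<open>Endomorphisms of a product of two cyclic groups\<close>

text \<open>The integers are generated by 1, so additivity modulo m forces linearity modulo m. Applied to the
coordinates of an endomorphism, read as functions of integer arguments, this produces its matrix.\<close>

lemma cong_additive_int:
  fixes g :: "int \<Rightarrow> int"
  assumes add: "\<And>x y. [g (x + y) = g x + g y] (mod m)"
  shows "[g x = x * g 1] (mod m)"
proof (induction x rule: int_induct[where k = 0])
  case base
  show ?case using add[of 0 0] by (simp add: cong_iff_dvd_diff)
next
  case (step1 i)
  then show ?case using add[of i 1] by (simp add: algebra_simps) (metis cong_add_rcancel cong_trans add.commute)
next
  case (step2 i)
  have "[g (i - 1) + g 1 = (i - 1) * g 1 + g 1] (mod m)"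
    using step2 add[of "i - 1" 1] by (simp add: algebra_simps) (metis cong_sym cong_trans)
  then show ?case by (simp add: cong_add_rcancel)
qed

locale cyclic_pair =
  fixes a r :: nat
  assumes a_pos: "a > 0" and r_pos: "r > 0"
begin

abbreviation G where "G \<equiv> integer_mod_group a \<times>\<times> integer_mod_group (a * r)"

text \<open>The entry range makes each endomorphism come from exactly one quadruple. The lower left entry of the
matrix is the multiple of r that is determined by the third component, see the next definition.\<close>

definition matrices :: "(int \<times> int \<times> int \<times> int) set" where
  "matrices = {0..<int a} \<times> {0..<int a} \<times> {0..<int a} \<times> {0..<int (a * r)}"

definition endo :: "int \<times> int \<times> int \<times> int \<Rightarrow> int \<times> int \<Rightarrow> int \<times> int" where
  "endo = (\<lambda>(\<alpha>, \<beta>, \<gamma>, \<delta>). \<lambda>(x, y)\<in>carrier G.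
     ((\<alpha> * x + \<beta> * y) mod int a, (\<gamma> * int r * x + \<delta> * y) mod int (a * r)))"

lemma carrier_G: "carrier G = {0..<int a} \<times> {0..<int (a * r)}"
  using a_pos r_pos by (simp add: carrier_integer_mod_group)

lemma comm_group_G: "comm_group G"
  by (rule group.group_comm_groupI) (auto simp: DirProd_group mult_DirProd' add.commute)

lemma group_G: "group G"
  using comm_group_G by (rule comm_group.axioms)

lemma order_G: "order G = a * (a * r)"
  by (simp only: order_def carrier_G card_cartesian_product card_atLeastLessThan_int diff_zero nat_int)

lemma r_times_mod: "[int r * (x mod int a) = int r * x] (mod int (a * r))"
  by (simp add: cong_def mod_mult_mult1 mult.commute flip: mult_mod_left)

lemma endo_hom: "endo m \<in> hom G G"
proof -
  obtain \<alpha> \<beta> \<gamma> \<delta> where m: "m = (\<alpha>, \<beta>, \<gamma>, \<delta>)" by (cases m)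
  show ?thesis
  proof (rule homI)
    fix p assume "p \<in> carrier G"
    then show "endo m p \<in> carrier G"
      unfolding m endo_def using a_pos r_pos by (auto simp only: carrier_G) auto
  next
    fix p q assume pq: "p \<in> carrier G" "q \<in> carrier G"
    obtain x y x' y' where e: "p = (x, y)" "q = (x', y')" by (cases p, cases q)
    have c: "p \<otimes>\<^bsub>G\<^esub> q \<in> carrier G" using pq group_G by (meson group.is_monoid monoid.m_closed)
    have 1: "[\<alpha> * ((x + x') mod int a) + \<beta> * ((y + y') mod int (a * r))
        = \<alpha> * (x + x') + \<beta> * (y + y')] (mod int a)"
      by (intro cong_add cong_mult cong_refl) (auto simp: cong_def mod_mod_cancel)
    have "[\<gamma> * int r * ((x + x') mod int a) = \<gamma> * int r * (x + x')] (mod int (a * r))"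
      using cong_mult[OF cong_refl r_times_mod, of \<gamma> "x + x'"] by (simp add: mult.assoc)
    moreover have "[\<delta> * ((y + y') mod int (a * r)) = \<delta> * (y + y')] (mod int (a * r))"
      by (simp add: cong_def mod_mult_right_eq del: of_nat_mult)
    ultimately have 3: "[\<gamma> * int r * ((x + x') mod int a) + \<delta> * ((y + y') mod int (a * r))
        = \<gamma> * int r * (x + x') + \<delta> * (y + y')] (mod int (a * r))"
      by (rule cong_add)
    have "endo m (p \<otimes>\<^bsub>G\<^esub> q)
        = ((\<alpha> * ((x + x') mod int a) + \<beta> * ((y + y') mod int (a * r))) mod int a,
           (\<gamma> * int r * ((x + x') mod int a) + \<delta> * ((y + y') mod int (a * r))) mod int (a * r))"
      using c by (simp add: endo_def m e)
    also have "\<dots> = ((\<alpha> * (x + x') + \<beta> * (y + y')) mod int a,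
        (\<gamma> * int r * (x + x') + \<delta> * (y + y')) mod int (a * r))"
      using 1 3 unfolding cong_def by (rule arg_cong2)
    also have "\<dots> = (((\<alpha> * x + \<beta> * y) + (\<alpha> * x' + \<beta> * y')) mod int a,
        ((\<gamma> * int r * x + \<delta> * y) + (\<gamma> * int r * x' + \<delta> * y')) mod int (a * r))"
      by (simp add: algebra_simps)
    also have "\<dots> = endo m p \<otimes>\<^bsub>G\<^esub> endo m q"
      using pq unfolding e by (simp add: endo_def m mod_add_eq del: of_nat_mult)
    finally show "endo m (p \<otimes>\<^bsub>G\<^esub> q) = endo m p \<otimes>\<^bsub>G\<^esub> endo m q" .
  qed
qed

text \<open>The images of the two generators are the columns of the matrix. The generators are written as
residues of 1 so that the trivial factors, where 1 is not a residue, need no separate treatment.\<close>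

lemma endo_generators:
  assumes "(\<alpha>, \<beta>, \<gamma>, \<delta>) \<in> matrices"
  shows "endo (\<alpha>, \<beta>, \<gamma>, \<delta>) (1 mod int a, 0) = (\<alpha>, \<gamma> * int r)"
    and "endo (\<alpha>, \<beta>, \<gamma>, \<delta>) (0, 1 mod int (a * r)) = (\<beta>, \<delta>)"
proof -
  have c: "(1 mod int a, 0) \<in> carrier G" "(0, 1 mod int (a * r)) \<in> carrier G"
    unfolding carrier_G using a_pos r_pos by (simp_all del: of_nat_mult)
  have b: "\<alpha> mod int a = \<alpha>" "\<beta> mod int a = \<beta>" "\<delta> mod int (a * r) = \<delta>"
    "\<gamma> * int r mod int (a * r) = \<gamma> * int r"
    using assms r_pos by (auto simp: matrices_def)
  have "\<gamma> * int r * (1 mod int a) mod int (a * r) = \<gamma> * int r mod int (a * r)"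
    using cong_mult[OF cong_refl r_times_mod, of \<gamma> 1] by (simp add: cong_def mult.assoc)
  then show "endo (\<alpha>, \<beta>, \<gamma>, \<delta>) (1 mod int a, 0) = (\<alpha>, \<gamma> * int r)"
    using c(1) b by (simp add: endo_def mod_mult_right_eq)
  have "\<beta> * (1 mod int (a * r)) mod int a = \<beta> mod int a"
    by (metis dvd_triv_left mod_mod_cancel mod_mult_right_eq mult.right_neutral of_nat_mult)
  then show "endo (\<alpha>, \<beta>, \<gamma>, \<delta>) (0, 1 mod int (a * r)) = (\<beta>, \<delta>)"
    using c(2) b by (simp add: endo_def mod_mult_right_eq del: of_nat_mult)
qed

lemma endo_inj: "inj_on endo matrices"
proof (rule inj_onI)
  fix m m' assume m: "m \<in> matrices" "m' \<in> matrices" and eq: "endo m = endo m'"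
  obtain \<alpha> \<beta> \<gamma> \<delta> \<alpha>' \<beta>' \<gamma>' \<delta>' where e: "m = (\<alpha>, \<beta>, \<gamma>, \<delta>)" "m' = (\<alpha>', \<beta>', \<gamma>', \<delta>')"
    by (cases m, cases m')
  show "m = m'"
    using endo_generators[OF m(1)[unfolded e]] endo_generators[OF m(2)[unfolded e]] eq r_pos
    unfolding e by simp
qed

text \<open>An endomorphism is determined by the images of the generators. The only constraint is that
a times the image of the first generator vanishes, which makes the second coordinate of that image
divisible by r.\<close>

lemma hom_is_endo:
  assumes f: "f \<in> hom G G" and ext: "f \<in> extensional (carrier G)"
  obtains m where "m \<in> matrices" "f = endo m"
proof -
  let ?a = "int a" and ?b = "int (a * r)"
  \<comment> \<open>The coordinates of the endomorphism, extended periodically to all integers.\<close>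
  define u where "u x y = fst (f (x mod ?a, y mod ?b))" for x y
  define v where "v x y = snd (f (x mod ?a, y mod ?b))" for x y
  have in_G: "(x mod ?a, y mod ?b) \<in> carrier G" for x y
    unfolding carrier_G using a_pos r_pos by auto
  have add: "[u (x + x') (y + y') = u x y + u x' y'] (mod ?a)"
       "[v (x + x') (y + y') = v x y + v x' y'] (mod ?b)" for x y x' y'
    using hom_mult[OF f in_G[of x y] in_G[of x' y']]
    by (simp_all add: u_def v_def mult_DirProd' cong_def mod_simps)
  have ran: "u x y \<in> {0..<?a}" "v x y \<in> {0..<?b}" for x y
    using hom_in_carrier[OF f in_G[of x y]] unfolding carrier_G u_def v_def by (auto simp: mem_Times_iff)
  have lin: "[g x y = x * g 1 0 + y * g 0 1] (mod n)"
    if g: "\<And>x y x' y'. [g (x + x') (y + y') = g x y + g x' y'] (mod n)" for g :: "int \<Rightarrow> int \<Rightarrow> int" and n x y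
  proof -
    have "[g x 0 = x * g 1 0] (mod n)"
      by (rule cong_additive_int) (use g[of _ _ 0 0] in simp)
    moreover have "[g 0 y = y * g 0 1] (mod n)"
      by (rule cong_additive_int) (use g[of 0 0] in simp)
    moreover have "[g x y = g x 0 + g 0 y] (mod n)" using g[of x 0 0 y] by simp
    ultimately show ?thesis by (meson cong_add cong_trans)
  qed
  \<comment> \<open>The first generator has order a, so its image is killed by a; this yields the factor r.\<close>
  have "[v ?a 0 = ?a * v 1 0] (mod ?b)" using lin[where g = v, OF add(2), of ?a 0] by simp
  moreover have "v ?a 0 = v 0 0" by (simp add: v_def)
  moreover have "[v 0 0 = 0] (mod ?b)" using lin[where g = v, OF add(2), of 0 0] by simp
  ultimately have "?b dvd ?a * v 1 0" by (metis cong_0_iff cong_sym cong_trans)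
  then have "int r dvd v 1 0" using a_pos by simp
  then obtain c where c: "v 1 0 = int r * c" ..
  have cr: "c \<in> {0..<?a}" using ran(2)[of 1 0] r_pos unfolding c
    by (auto simp: zero_le_mult_iff mult.commute[of "int a"])
  show thesis
  proof
    show "(u 1 0, u 0 1, c, v 0 1) \<in> matrices"
      using ran[of 1 0] ran[of 0 1] cr by (auto simp: matrices_def)
    show "f = endo (u 1 0, u 0 1, c, v 0 1)"
    proof
      fix p
      show "f p = endo (u 1 0, u 0 1, c, v 0 1) p"
      proof (cases "p \<in> carrier G")
        case True
        obtain x y where p: "p = (x, y)" by (cases p)
        have xy: "x mod ?a = x" "y mod ?b = y" using True unfolding p carrier_G by auto
        have "u x y = (x * u 1 0 + y * u 0 1) mod ?a" "v x y = (x * v 1 0 + y * v 0 1) mod ?b"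
          using lin[where g = u, OF add(1), of x y] lin[where g = v, OF add(2), of x y] ran[of x y] by (auto simp: cong_def)
        moreover have "f p = (u x y, v x y)" by (simp add: u_def v_def xy p del: of_nat_mult)
        ultimately show ?thesis using True by (simp add: endo_def p c algebra_simps)
      next
        case False
        then show ?thesis using ext by (cases p) (auto simp: endo_def extensional_def)
      qed
    qed
  qed
qed

end

section \<open>The invertibility criterion\<close>

lemma coprime_primeI:
  fixes a b :: int
  assumes "b \<noteq> 0" and "\<And>p. Factorial_Ring.prime p \<Longrightarrow> p dvd a \<Longrightarrow> p dvd b \<Longrightarrow> False"
  shows "coprime a b"
proof (rule ccontr)
  assume "\<not> coprime a b"
  then have "\<not> is_unit (gcd a b)" by (simp add: coprime_iff_gcd_eq_1)
  moreover have "gcd a b \<noteq> 0" using assms(1) by simp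
  ultimately obtain p where "Factorial_Ring.prime p" "p dvd gcd a b" using prime_divisor_exists by blast
  then show False using assms(2) by auto
qed

text \<open>If the condition holds, Cramer's rule applied to a kernel element (x, y) gives that D x vanishes
modulo a and D y vanishes modulo a r; once x vanishes, so does \<delta> y, and the second coprimality
finishes. Conversely, a prime p dividing both D and a makes the matrix with rows (\<alpha>, r\<beta>) and
(\<gamma>, \<delta>) singular modulo p, and a null vector (u, v) of it yields the kernel element
((a/p) u, (a r/p) v). A prime that divides D, \<delta>
and a r but not a divides r, and then (0, a r/p) is in the kernel.\<close>

lemma trivial_kernel_iff:
  fixes a r \<alpha> \<beta> \<gamma> \<delta> :: int
  assumes "a > 0" "r > 0"
  defines "D \<equiv> \<alpha> * \<delta> - r * \<beta> * \<gamma>"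
  shows "(\<forall>x y. a dvd \<alpha> * x + \<beta> * y \<and> a * r dvd \<gamma> * r * x + \<delta> * y \<longrightarrow> a dvd x \<and> a * r dvd y)
    \<longleftrightarrow> coprime D a \<and> coprime (gcd D \<delta>) (a * r)" (is "?L \<longleftrightarrow> ?R")
proof
  assume R: ?R
  show ?L
  proof (intro allI impI)
    fix x y assume xy: "a dvd \<alpha> * x + \<beta> * y \<and> a * r dvd \<gamma> * r * x + \<delta> * y"
    have "a dvd \<delta> * (\<alpha> * x + \<beta> * y) - \<beta> * (\<gamma> * r * x + \<delta> * y)"
      using xy by (meson dvd_diff dvd_mult dvd_mult_left)
    also have "\<dots> = D * x" by (simp add: D_def algebra_simps)
    finally have x: "a dvd x" using R by (simp add: coprime_commute coprime_dvd_mult_right_iff)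
    have "a * r dvd \<alpha> * (\<gamma> * r * x + \<delta> * y) - \<gamma> * ((\<alpha> * x + \<beta> * y) * r)"
      using xy by (intro dvd_diff dvd_mult mult_dvd_mono) auto
    also have "\<dots> = D * y" by (simp add: D_def algebra_simps)
    finally have "a * r dvd D * y" .
    moreover have "a * r dvd \<delta> * y"
    proof -
      have "a * r dvd \<gamma> * (x * r)" using x by (intro dvd_mult mult_dvd_mono) auto
      then have "a * r dvd (\<gamma> * r * x + \<delta> * y) - \<gamma> * (x * r)" using xy by (intro dvd_diff) auto
      then show ?thesis by (simp add: algebra_simps)
    qed
    ultimately have "a * r dvd gcd (D * y) (\<delta> * y)" by simp
    also have "gcd (D * y) (\<delta> * y) = gcd D \<delta> * \<bar>y\<bar>"
      using gcd_mult_distrib_int[of y D \<delta>] by (simp add: mult.commute)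
    finally have "a * r dvd y" using R by (simp add: coprime_commute coprime_dvd_mult_right_iff)
    then show "a dvd x \<and> a * r dvd y" using x by simp
  qed
next
  assume L: ?L
  have no_common: False if p: "Factorial_Ring.prime p" "p dvd D" "p dvd a" for p
  proof -
    from p obtain a' where a': "a = p * a'" by blast
    have a'0: "a' \<noteq> 0" using a' assms by auto
    have lift: "p dvd u \<and> p dvd v" if uv: "p dvd \<alpha> * u + \<beta> * r * v" "p dvd \<gamma> * u + \<delta> * v" for u v
    proof -
      have "p * a' dvd (\<alpha> * u + \<beta> * r * v) * a'" using uv by (intro mult_dvd_mono) auto
      moreover have "p * (a' * r) dvd (\<gamma> * u + \<delta> * v) * (a' * r)" using uv by (intro mult_dvd_mono) auto
      ultimately have "p * a' dvd a' * u \<and> p * (a' * r) dvd a' * r * v"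
        using L[rule_format, of "a' * u" "a' * r * v"] unfolding a' by (simp add: algebra_simps)
      then show ?thesis using a'0 assms(2) by (simp add: mult.assoc mult.left_commute[of p])
    qed
    \<comment> \<open>Up to sign, both columns of the adjugate matrix are null vectors modulo p, so all entries vanish modulo p; then
(1, 0) is a null vector too.\<close>
    have "p dvd \<delta> \<and> p dvd - \<gamma>"
      by (rule lift) (use p in \<open>auto simp: D_def algebra_simps\<close>)
    moreover from this have "p dvd \<beta> * r \<and> p dvd - \<alpha>"
      by (intro lift) (auto simp: algebra_simps)
    ultimately have "p dvd 1 \<and> p dvd 0" by (intro lift) auto
    then show False using p by auto
  qed
  have "coprime D a" using no_common assms by (intro coprime_primeI) auto
  moreover have "coprime (gcd D \<delta>) (a * r)"
  proof (rule coprime_primeI)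
    fix p :: int assume p: "Factorial_Ring.prime p" "p dvd gcd D \<delta>" "p dvd a * r"
    then have "p dvd r" using no_common by (auto simp: prime_dvd_mult_iff)
    then obtain r' where r': "r = p * r'" by blast
    from p obtain d where d: "\<delta> = p * d" by auto
    have "a * r dvd a * r'"
      using L[rule_format, of 0 "a * r'"] unfolding d r' by (simp add: algebra_simps)
    then show False using assms p unfolding r' by (auto dest: zdvd_imp_le)
  qed (use assms in simp)
  ultimately show ?R ..
qed

context cyclic_pair
begin

definition invertible :: "int \<times> int \<times> int \<times> int \<Rightarrow> bool" where
  "invertible = (\<lambda>(\<alpha>, \<beta>, \<gamma>, \<delta>). let D = \<alpha> * \<delta> - int r * \<beta> * \<gamma> in
     coprime D (int a) \<and> coprime (gcd D \<delta>) (int (a * r)))"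

text \<open>Residues are replaced by arbitrary integers here: the kernel equations depend only on the classes
of x modulo a and of y modulo a r, so the divisibility criterion above applies.\<close>

lemma endo_inj_iff: "inj_on (endo m) (carrier G) \<longleftrightarrow> invertible m"
proof -
  obtain \<alpha> \<beta> \<gamma> \<delta> where m: "m = (\<alpha>, \<beta>, \<gamma>, \<delta>)" by (cases m)
  let ?K = "\<lambda>x y. int a dvd \<alpha> * x + \<beta> * y \<and> int a * int r dvd \<gamma> * int r * x + \<delta> * y"
  have K_mod: "?K (x mod int a) (y mod int (a * r)) \<longleftrightarrow> ?K x y" for x y
  proof -
    have "[\<alpha> * (x mod int a) + \<beta> * (y mod int (a * r)) = \<alpha> * x + \<beta> * y] (mod int a)"
      by (intro cong_add cong_mult cong_refl) (auto simp: cong_def mod_mod_cancel)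
    moreover have "[\<gamma> * (int r * (x mod int a)) + \<delta> * (y mod int (a * r)) = \<gamma> * (int r * x) + \<delta> * y] (mod int (a * r))"
      by (intro cong_add cong_mult cong_refl r_times_mod) (auto simp: cong_def)
    ultimately show ?thesis by (simp add: cong_dvd_iff mult.assoc)
  qed
  have "inj_on (endo m) (carrier G) \<longleftrightarrow> (\<forall>p\<in>carrier G. endo m p = \<one>\<^bsub>G\<^esub> \<longrightarrow> p = \<one>\<^bsub>G\<^esub>)"
    using inj_on_one_iff'[OF endo_hom group_G group_G] by auto
  also have "\<dots> \<longleftrightarrow> (\<forall>x\<in>{0..<int a}. \<forall>y\<in>{0..<int (a * r)}. ?K x y \<longrightarrow> x = 0 \<and> y = 0)"
  proof -
    have "endo m (x, y) = \<one>\<^bsub>G\<^esub> \<longleftrightarrow> ?K x y" if "x \<in> {0..<int a}" "y \<in> {0..<int (a * r)}" for x y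
      using that by (simp add: m endo_def carrier_G mod_eq_0_iff_dvd del: carrier_DirProd)
    then show ?thesis unfolding carrier_G by (simp del: of_nat_mult)
  qed
  also have "\<dots> \<longleftrightarrow> (\<forall>x y. ?K x y \<longrightarrow> int a dvd x \<and> int a * int r dvd y)"
  proof (intro iffI allI impI ballI)
    fix x y
    assume L: "\<forall>x\<in>{0..<int a}. \<forall>y\<in>{0..<int (a * r)}. ?K x y \<longrightarrow> x = 0 \<and> y = 0"
      and K: "?K x y"
    have "x mod int a \<in> {0..<int a}" "y mod int (a * r) \<in> {0..<int (a * r)}"
      using a_pos r_pos by (simp_all del: of_nat_mult)
    then have "x mod int a = 0 \<and> y mod int (a * r) = 0"
      using L K K_mod[of x y] by blast
    then show "int a dvd x \<and> int a * int r dvd y" by (simp only: dvd_eq_mod_eq_0 of_nat_mult)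
  next
    fix x y
    assume "\<forall>x y. ?K x y \<longrightarrow> int a dvd x \<and> int a * int r dvd y" "?K x y"
      and xy: "x \<in> {0..<int a}" "y \<in> {0..<int (a * r)}"
    then have "int a dvd x \<and> int a * int r dvd y" by blast
    then have "int a dvd x" "int (a * r) dvd y" by (simp_all only: of_nat_mult)
    then show "x = 0 \<and> y = 0" using xy by (metis atLeastLessThan_iff dvd_imp_mod_0 mod_pos_pos_trivial)
  qed
  also have "\<dots> \<longleftrightarrow> invertible m"
    using trivial_kernel_iff[of "int a" "int r" \<alpha> \<beta> \<gamma> \<delta>] a_pos r_pos
    by (simp add: m invertible_def Let_def)
  finally show ?thesis .
qed

lemma card_auto: "card (auto G) = card {m \<in> matrices. invertible m}"
proof -
  have fin: "finite (carrier G)" unfolding carrier_G by simp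
  have "auto G = endo ` {m \<in> matrices. invertible m}"
  proof (intro equalityI subsetI)
    fix f assume f: "f \<in> auto G"
    then obtain m where m: "m \<in> matrices" "f = endo m"
      by (auto simp: auto_def Bij_def elim: hom_is_endo)
    moreover have "invertible m" using f by (auto simp: auto_def Bij_def bij_betw_def m simp flip: endo_inj_iff)
    ultimately show "f \<in> endo ` {m \<in> matrices. invertible m}" by auto
  next
    fix f assume "f \<in> endo ` {m \<in> matrices. invertible m}"
    then obtain m where m: "f = endo m" "invertible m" by auto
    have "endo m ` carrier G = carrier G"
      using endo_inj_iff[of m] m fin hom_carrier[OF endo_hom] by (intro endo_inj_surj) simp_all
    then have "bij_betw (endo m) (carrier G) (carrier G)"
      using endo_inj_iff[of m] m by (simp add: bij_betw_def)
    moreover have "endo m \<in> extensional (carrier G)" by (cases m) (simp add: endo_def)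
    ultimately show "f \<in> auto G" using endo_hom m by (auto simp: auto_def Bij_def)
  qed
  moreover have "inj_on endo {m \<in> matrices. invertible m}"
    using endo_inj by (rule inj_on_subset) auto
  ultimately show ?thesis by (simp add: card_image)
qed

end
section \<open>Counting invertible matrices\<close>

lemma card_coprime_residues:
  assumes "n > 0"
  shows "card {x \<in> {0..<int n}. coprime x (int n)} = totient n"
proof (cases "n = 1")
  case True
  then have "{x \<in> {0..<int n}. coprime x (int n)} = {0}" by auto
  then show ?thesis using True by simp
next
  case False
  then have n: "n > 1" using assms by simp
  have "{x \<in> {0..<int n}. coprime x (int n)} = int ` totatives n"
  proof (intro equalityI subsetI)
    fix x assume x: "x \<in> {x \<in> {0..<int n}. coprime x (int n)}"
    then have "x \<noteq> 0" using n by auto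
    then have "nat x \<in> totatives n" using x
      by (auto simp: in_totatives_iff simp flip: coprime_int_iff)
    then show "x \<in> int ` totatives n" using x by (intro image_eqI[of _ _ "nat x"]) simp_all
  next
    fix x assume "x \<in> int ` totatives n"
    then show "x \<in> {x \<in> {0..<int n}. coprime x (int n)}"
      using totatives_less[OF _ n] by (auto simp: in_totatives_iff)
  qed
  then show ?thesis by (simp add: totient_def card_image)
qed

lemma sum_periodic:
  fixes g :: "int \<Rightarrow> nat"
  assumes "\<And>x. g (x mod int m) = g x"
  shows "(\<Sum>x\<in>{0..<int (m * q)}. g x) = q * (\<Sum>x\<in>{0..<int m}. g x)"
proof (induction q)
  case (Suc q)
  have shift: "g (x + int (m * q)) = g x" for x
    using assms[of "x + int (m * q)"] assms[of x] by simp
  have "{0..<int (m * Suc q)} = {0..<int (m * q)} \<union> {int (m * q)..<int (m * q) + int m}"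
    using zero_le_imp_eq_int by (subst ivl_disj_un(17)) (simp_all add: algebra_simps)
  then have "(\<Sum>x\<in>{0..<int (m * Suc q)}. g x)
      = (\<Sum>x\<in>{0..<int (m * q)}. g x) + (\<Sum>x\<in>{int (m * q)..<int (m * q) + int m}. g x)"
    by (simp add: sum.union_disjoint del: of_nat_mult)
  also have "(\<Sum>x\<in>{int (m * q)..<int (m * q) + int m}. g x) = (\<Sum>x\<in>{0..<int m}. g (x + int (m * q)))"
    by (rule sum.reindex_bij_witness[where i = "\<lambda>x. x + int (m * q)" and j = "\<lambda>x. x - int (m * q)"]) auto
  finally show ?case using Suc by (simp add: shift del: of_nat_mult)
qed simp

text \<open>The coefficients count the pairs (x, y) modulo 6 with a given product. By the Chinese remainder
theorem they are products of the counts 3, 1 modulo 2 and 5, 2, 2 modulo 3.\<close>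

lemma sum_products_mod_6:
  fixes g :: "int \<Rightarrow> nat"
  shows "(\<Sum>x\<in>{0..<6}. \<Sum>y\<in>{0..<6}. g (x * y mod 6))
    = 15 * g 0 + 2 * g 1 + 6 * g 2 + 5 * g 3 + 6 * g 4 + 2 * g 5"
proof -
  have six: "{0..<6::int} = {0, 1, 2, 3, 4, 5}" by auto
  show ?thesis by (simp add: six)
qed

text \<open>The order of the general linear group of rank two over the integers modulo 6. The determinant depends
only on the two products \<alpha>\<delta> and \<beta>\<gamma>, so the distribution of products, used for each of them,
replaces an enumeration of all 1296 matrices by one of 36 pairs of products.\<close>

lemma sum_GL2_mod_6:
  "(\<Sum>\<alpha>\<in>{0..<6::int}. \<Sum>\<delta>\<in>{0..<6}. \<Sum>\<beta>\<in>{0..<6}. \<Sum>\<gamma>\<in>{0..<6}.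
     of_bool (coprime (\<alpha> * \<delta> - \<beta> * \<gamma>) 6)) = (288::nat)"
proof -
  define k :: "int \<Rightarrow> int \<Rightarrow> nat" where "k s t = of_bool (coprime (s - t) 6)" for s t
  have k: "of_bool (coprime (\<alpha> * \<delta> - \<beta> * \<gamma>) 6) = k (\<alpha> * \<delta> mod 6) (\<beta> * \<gamma> mod 6)" for \<alpha> \<beta> \<gamma> \<delta>
  proof -
    have "[\<alpha> * \<delta> - \<beta> * \<gamma> = \<alpha> * \<delta> mod 6 - \<beta> * \<gamma> mod 6] (mod 6)"
      by (simp add: cong_def mod_diff_eq)
    then have "coprime (\<alpha> * \<delta> - \<beta> * \<gamma>) 6 \<longleftrightarrow> coprime (\<alpha> * \<delta> mod 6 - \<beta> * \<gamma> mod 6) 6"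
      by (meson cong_imp_coprime cong_sym)
    then show ?thesis by (simp add: k_def)
  qed
  have units: "coprime (x::int) 6 \<longleftrightarrow> x mod 6 \<in> {1, 5}" for x
  proof -
    have "coprime x 6 \<longleftrightarrow> coprime (x mod 6) 6" by simp
    moreover have "x mod 6 \<in> {0, 1, 2, 3, 4, 5}" by auto
    moreover have "\<not> coprime (2::int) 6" "\<not> coprime (3::int) 6" "\<not> coprime (4::int) 6" "coprime (5::int) 6"
      by code_simp+
    ultimately show ?thesis by fastforce
  qed
  let ?row = "\<lambda>s. 15 * k s 0 + 2 * k s 1 + 6 * k s 2 + 5 * k s 3 + 6 * k s 4 + 2 * k s 5"
  have "(\<Sum>\<alpha>\<in>{0..<6::int}. \<Sum>\<delta>\<in>{0..<6}. \<Sum>\<beta>\<in>{0..<6}. \<Sum>\<gamma>\<in>{0..<6}.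
      of_bool (coprime (\<alpha> * \<delta> - \<beta> * \<gamma>) 6))
    = (\<Sum>\<alpha>\<in>{0..<6::int}. \<Sum>\<delta>\<in>{0..<6}. ?row (\<alpha> * \<delta> mod 6))"
    unfolding k by (intro sum.cong refl sum_products_mod_6)
  also have "\<dots> = 15 * ?row 0 + 2 * ?row 1 + 6 * ?row 2 + 5 * ?row 3 + 6 * ?row 4 + 2 * ?row 5"
    by (rule sum_products_mod_6[of ?row])
  also have "\<dots> = 288"
    by (simp add: k_def units)
  finally show ?thesis .
qed

text \<open>The hypothesis on a implies that each prime divisor of a divides r. Then each prime divisor of a r
divides r as well, and modulo such a prime D is the product of the diagonal entries.\<close>

lemma coprime_det_iff:
  fixes a r \<alpha> \<beta> \<gamma> \<delta> :: int
  assumes "a > 0" "r > 0" "a dvd r ^ n"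
  defines "D \<equiv> \<alpha> * \<delta> - r * \<beta> * \<gamma>"
  shows "coprime D a \<and> coprime (gcd D \<delta>) (a * r) \<longleftrightarrow> coprime \<alpha> a \<and> coprime \<delta> (a * r)" (is "?L \<longleftrightarrow> ?R")
proof -
  have r: "p dvd r" if "Factorial_Ring.prime p" "p dvd a \<or> p dvd a * r" for p
    using that assms(3) by (meson dvd_trans prime_dvd_multD prime_dvd_power)
  have D: "p dvd D \<longleftrightarrow> p dvd \<alpha> * \<delta>" if "p dvd r" for p
    using that unfolding D_def mult.assoc by (meson dvd_diff_left_iff dvd_mult2)
  show ?thesis
  proof
    assume ?L
    have 1: False if "Factorial_Ring.prime p" "p dvd \<alpha>" "p dvd a" for p
      using D[OF r] that \<open>?L\<close> by (meson not_prime_unit coprime_common_divisor dvd_mult2)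
    have 2: False if "Factorial_Ring.prime p" "p dvd \<delta>" "p dvd a * r" for p
      using D[OF r] that \<open>?L\<close> by (meson not_prime_unit coprime_common_divisor dvd_mult gcd_greatest)
    have "coprime \<alpha> a"
      by (rule coprime_primeI) (use assms(1) in simp, erule (2) 1)
    moreover have "coprime \<delta> (a * r)"
      by (rule coprime_primeI) (use assms(1,2) in simp, erule (2) 2)
    ultimately show ?R ..
  next
    assume ?R
    have 1: False if "Factorial_Ring.prime p" "p dvd D" "p dvd a" for p
      using D[OF r] that \<open>?R\<close> by (meson not_prime_unit coprime_common_divisor dvd_mult2 prime_dvd_multD)
    have "coprime D a"
      by (rule coprime_primeI) (use assms(1) in simp, erule (2) 1)
    moreover have "coprime (gcd D \<delta>) (a * r)" using \<open>?R\<close> coprime_divisors[of "gcd D \<delta>" \<delta> "a * r" "a * r"] by simp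
    ultimately show ?L ..
  qed
qed

context cyclic_pair
begin

lemma card_auto_eq_totients:
  assumes "a dvd r ^ n"
  shows "card (auto G) = totient a * a * a * totient (a * r)"
proof -
  have dvd: "int a dvd int r ^ n" using assms by (metis of_nat_dvd_iff of_nat_power)
  have "{m \<in> matrices. invertible m}
      = {\<alpha> \<in> {0..<int a}. coprime \<alpha> (int a)} \<times> {0..<int a} \<times> {0..<int a}
        \<times> {\<delta> \<in> {0..<int (a * r)}. coprime \<delta> (int (a * r))}"
    using a_pos r_pos coprime_det_iff[OF _ _ dvd]
    by (auto simp: matrices_def invertible_def Let_def simp del: coprime_mult_right_iff)
  then show ?thesis
    using card_coprime_residues[of a] card_coprime_residues[of "a * r"] a_pos r_pos
    by (simp only: card_auto card_cartesian_product card_atLeastLessThan_int diff_zero nat_int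
        nat_0_less_mult_iff mult.assoc)
qed

text \<open>The hypothesis on q implies that q has no prime divisors other than 2 and 3, so that being a unit
modulo a can be tested modulo 6. The count is then a sum of a function that is periodic modulo 6
in each of the four entries, and each of them contributes a factor q.\<close>

lemma card_auto_homogeneous:
  assumes "r = 1" "a = 6 * q" "q dvd 6 ^ n"
  shows "card (auto G) = 288 * q ^ 4"
proof -
  define F :: "int \<Rightarrow> int \<Rightarrow> int \<Rightarrow> int \<Rightarrow> nat"
    where "F \<alpha> \<delta> \<beta> \<gamma> = of_bool (coprime (\<alpha> * \<delta> - \<beta> * \<gamma>) 6)" for \<alpha> \<delta> \<beta> \<gamma>
  let ?I = "{0..<int (6 * q)}" and ?J = "{0..<6::int}"
  have "int q dvd 6 ^ n" using assms(3) by (metis of_nat_dvd_iff of_nat_numeral of_nat_power)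
  then have "coprime D (int q)" if "coprime D 6" for D
    using that by (meson coprime_divisors coprime_power_right_iff dvd_refl)
  then have unit: "coprime D (int a) \<longleftrightarrow> coprime D 6" for D
    by (auto simp: assms(2))
  have inv: "invertible (\<alpha>, \<beta>, \<gamma>, \<delta>) \<longleftrightarrow> coprime (\<alpha> * \<delta> - \<beta> * \<gamma>) 6" for \<alpha> \<beta> \<gamma> \<delta>
  proof -
    have "coprime (gcd D \<delta>) 6" if "coprime D 6" for D :: int
      using that by (meson coprime_divisors dvd_refl gcd_dvd1)
    then show ?thesis unfolding invertible_def by (auto simp: assms(1) Let_def unit)
  qed
  have F_cong: "F \<alpha> \<delta> \<beta> \<gamma> = F \<alpha>' \<delta>' \<beta>' \<gamma>'"
    if "[\<alpha> = \<alpha>'] (mod 6)" "[\<delta> = \<delta>'] (mod 6)" "[\<beta> = \<beta>'] (mod 6)" "[\<gamma> = \<gamma>'] (mod 6)"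
    for \<alpha> \<delta> \<beta> \<gamma> \<alpha>' \<delta>' \<beta>' \<gamma>'
  proof -
    have "[\<alpha> * \<delta> - \<beta> * \<gamma> = \<alpha>' * \<delta>' - \<beta>' * \<gamma>'] (mod 6)"
      using that by (intro cong_diff cong_mult)
    then have "coprime (\<alpha> * \<delta> - \<beta> * \<gamma>) 6 \<longleftrightarrow> coprime (\<alpha>' * \<delta>' - \<beta>' * \<gamma>') 6"
      by (meson cong_imp_coprime cong_sym)
    then show ?thesis by (simp add: F_def)
  qed
  have mod6: "F (\<alpha> mod 6) \<delta> \<beta> \<gamma> = F \<alpha> \<delta> \<beta> \<gamma>" "F \<alpha> (\<delta> mod 6) \<beta> \<gamma> = F \<alpha> \<delta> \<beta> \<gamma>"
    "F \<alpha> \<delta> (\<beta> mod 6) \<gamma> = F \<alpha> \<delta> \<beta> \<gamma>" "F \<alpha> \<delta> \<beta> (\<gamma> mod 6) = F \<alpha> \<delta> \<beta> \<gamma>" for \<alpha> \<delta> \<beta> \<gamma>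
    by (auto intro!: F_cong simp: cong_def)
  have per: "(\<Sum>x\<in>?I. g x) = q * (\<Sum>x\<in>?J. g x)" if "\<And>x. g (x mod 6) = g x" for g :: "int \<Rightarrow> nat"
    using sum_periodic[of g 6 q] that by simp
  have all: "matrices = ?I \<times> ?I \<times> ?I \<times> ?I"
    unfolding matrices_def using assms(1,2) by simp
  have "card (auto G) = (\<Sum>m\<in>matrices. of_bool (invertible m))"
    by (simp add: card_auto matrices_def Int_def)
  also have "\<dots> = (\<Sum>\<alpha>\<in>?I. \<Sum>\<beta>\<in>?I. \<Sum>\<gamma>\<in>?I. \<Sum>\<delta>\<in>?I. F \<alpha> \<delta> \<beta> \<gamma>)"
    by (simp only: all sum.cartesian_product' inv F_def)
  \<comment> \<open>Moving \<delta> next to \<alpha> groups the two products of the determinant.\<close>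
  also have "\<dots> = (\<Sum>\<alpha>\<in>?I. \<Sum>\<beta>\<in>?I. \<Sum>\<delta>\<in>?I. \<Sum>\<gamma>\<in>?I. F \<alpha> \<delta> \<beta> \<gamma>)"
    by (intro sum.cong refl sum.swap)
  also have "\<dots> = (\<Sum>\<alpha>\<in>?I. \<Sum>\<delta>\<in>?I. \<Sum>\<beta>\<in>?I. \<Sum>\<gamma>\<in>?I. F \<alpha> \<delta> \<beta> \<gamma>)"
    by (intro sum.cong refl sum.swap)
  also have "\<dots> = (\<Sum>\<alpha>\<in>?I. \<Sum>\<delta>\<in>?I. \<Sum>\<beta>\<in>?I. q * (\<Sum>\<gamma>\<in>?J. F \<alpha> \<delta> \<beta> \<gamma>))"
    by (intro sum.cong refl per mod6)
  also have "\<dots> = (\<Sum>\<alpha>\<in>?I. \<Sum>\<delta>\<in>?I. q * (\<Sum>\<beta>\<in>?J. q * (\<Sum>\<gamma>\<in>?J. F \<alpha> \<delta> \<beta> \<gamma>)))"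
    by (intro sum.cong refl per) (simp only: mod6)
  also have "\<dots> = (\<Sum>\<alpha>\<in>?I. q * (\<Sum>\<delta>\<in>?J. q * (\<Sum>\<beta>\<in>?J. q * (\<Sum>\<gamma>\<in>?J. F \<alpha> \<delta> \<beta> \<gamma>))))"
    by (intro sum.cong refl per) (simp only: mod6)
  also have "\<dots> = q * (\<Sum>\<alpha>\<in>?J. q * (\<Sum>\<delta>\<in>?J. q * (\<Sum>\<beta>\<in>?J. q * (\<Sum>\<gamma>\<in>?J. F \<alpha> \<delta> \<beta> \<gamma>))))"
    by (intro per) (simp only: mod6)
  also have "\<dots> = q ^ 4 * (\<Sum>\<alpha>\<in>?J. \<Sum>\<delta>\<in>?J. \<Sum>\<beta>\<in>?J. \<Sum>\<gamma>\<in>?J. F \<alpha> \<delta> \<beta> \<gamma>)"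
    by (simp only: sum_distrib_left[symmetric]) (simp add: eval_nat_numeral)
  also have "\<dots> = q ^ 4 * 288" unfolding F_def sum_GL2_mod_6 ..
  finally show ?thesis by simp
qed

lemma nat_group_with_aut_ratio:
  assumes "real (card (auto G)) / real (a * (a * r)) = c"
  shows "\<exists>N :: nat monoid. comm_group N \<and> finite (carrier N) \<and>
    real (order (AutoGroup N)) / real (order N) = c"
proof -
  have "finite (carrier G)" unfolding carrier_G by simp
  then obtain N :: "nat monoid"
    where N: "comm_group N" "finite (carrier N)" "to_nat \<in> iso G N"
    using comm_group_nat_copy[OF comm_group_G] by blast
  have "order (AutoGroup N) = card (auto G)"
    using card_auto_iso[OF group_G comm_group.axioms(2)[OF N(1)] N(3)]
    by (simp add: order_def AutoGroup_def)
  moreover have "order N = a * (a * r)"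
    using N(3) bij_betw_same_card order_G by (fastforce simp: iso_def order_def)
  ultimately show ?thesis using N assms by metis
qed

end

section \<open>Realizing the powers of two\<close>

theorem theorem2:
  fixes k :: nat
  shows "\<exists>G :: nat monoid. comm_group G \<and> finite (carrier G) \<and>
    real (order (AutoGroup G)) / real (order G) = 2 ^ k"
proof -
  consider (even) j where "k = 2 * j" | (one) "k = 1" | (odd) j where "k = 2 * j + 3"
  proof (cases "even k")
    case False
    then obtain i where "k = 2 * i + 1" by (elim oddE)
    then show ?thesis using that(2) that(3)[of "i - 1"] by (cases i) auto
  qed (use that in auto)
  then show ?thesis
  proof cases
    case even
    interpret cyclic_pair "2 ^ Suc j" 2 by unfold_locales auto
    have "card (auto G) = totient (2 ^ Suc j) * 2 ^ Suc j * 2 ^ Suc j * totient (2 ^ Suc (Suc j))"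
      using card_auto_eq_totients[of "Suc j"] by (simp add: mult.commute)
    also have "\<dots> = 2 ^ j * 2 ^ Suc j * 2 ^ Suc j * 2 ^ Suc j"
      by (simp only: totient_prime_power_Suc two_is_prime_nat) simp
    finally show ?thesis
      by (intro nat_group_with_aut_ratio) (simp add: even field_simps power_mult power2_eq_square)
  next
    case one
    \<comment> \<open>The groups of the third case give no ratio below 8, so the exponent 1 needs its own group.\<close>
    interpret cyclic_pair 3 6 by unfold_locales auto
    have "totient 18 = totient 2 * totient 9"
      using totient_mult_coprime[of 2 9] by simp
    also have "\<dots> = 6" by simp
    finally have "card (auto G) = 108"
      using card_auto_eq_totients[of 1] by simp
    then show ?thesis by (intro nat_group_with_aut_ratio) (simp add: one)
  next
    case odd
    interpret cyclic_pair "6 * 2 ^ j" 1 by unfold_locales auto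
    have "(2::nat) ^ j dvd 6 ^ j" by (rule dvd_power_same) simp
    then have "card (auto G) = 288 * (2 ^ j) ^ 4"
      by (intro card_auto_homogeneous) auto
    then show ?thesis
      by (intro nat_group_with_aut_ratio) (simp add: odd field_simps power_add power_mult eval_nat_numeral)
  qed
qed

end
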